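(* For each positive integer $n$, let $L_n=([n],EL_n)$ be the path with $EL_n=\{\{i,i+1\} : i\in[n-1]\}$. Then $$\mathrm{vol}(L_n)=\frac{E_n}{n!},$$ where $E_n$ is the $n$-th Euler number. Hence, with the convention $\mathrm{vol}(L_0)=1$, the generating function is $$\sum_{n\ge 0}\mathrm{vol}(L_n)x^n=\sec x+\tan x .$$
   Context: $[n]=\{1,\dots,n\}$. For a finite simple graph $G=(VG,EG)$, the graph polytope is $P(G)=\{x\in[0,1]^{VG} : x_i+x_j\le 1 \text{ for every edge } ij\in EG\}$, and $\mathrm{vol}(G)$ denotes the $|VG|$-dimensional volume (Lebesgue measure) of $P(G)$. The Euler numbers $E_n$ are the Euler zigzag numbers: $E_0=1$ and, for $n\ge1$, $E_n$ is the number of permutations $a_1a_2\cdots a_n$ of $[n]$ with $a_1<a_2>a_3<a_4>\cdots$ ($E_0,E_1,E_2,\dots=1,1,1,2,5,16,\dots$). The generating function identity is an identity of power series in $x$ (Taylor expansion at $0$). *)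

theory Defs
  imports "HOL-Analysis.Analysis" "HOL-Combinatorics.Permutations"
begin

type_synonym 'a graph = "'a set \<times> 'a set set"

definition simple_graph :: "'a graph \<Rightarrow> bool" where
  "simple_graph G \<longleftrightarrow>
     finite (fst G) \<and> (\<forall>e \<in> snd G. e \<subseteq> fst G \<and> card e = 2)"

text \<open>Points of the cube are functions on the vertex set, extended by
  \<open>undefined\<close> outside of it, as in the space of the product measure below.\<close>

definition graph_polytope :: "'a graph \<Rightarrow> ('a \<Rightarrow> real) set" where
  "graph_polytope G =
     {x \<in> fst G \<rightarrow>\<^sub>E {0..1}. \<forall>i j. {i, j} \<in> snd G \<longrightarrow> x i + x j \<le> 1}"

definition graph_vol :: "'a graph \<Rightarrow> real" where
  "graph_vol G = measure (\<Pi>\<^sub>M i\<in>fst G. lborel) (graph_polytope G)"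

definition path_graph :: "nat \<Rightarrow> nat graph" where
  "path_graph n = ({1..n}, {{i, i + 1} | i. i \<in> {1..n - 1}})"

definition euler_number :: "nat \<Rightarrow> nat" where
  "euler_number n =
     (if n = 0 then 1
      else card {a. a permutes {1..n} \<and>
             (\<forall>i \<in> {1..n - 1}. if odd i then a i < a (i + 1) else a i > a (i + 1))})"

lemma simple_graph_path_graph: "simple_graph (path_graph n)"
  by (auto simp: simple_graph_def path_graph_def)

lemma sets_graph_polytope:
  assumes "simple_graph G"
  shows "graph_polytope G \<in> sets (\<Pi>\<^sub>M i\<in>fst G. lborel)"
proof -
  let ?M = "\<Pi>\<^sub>M i\<in>fst G. (lborel :: real measure)"
  let ?P = "{(i, j). {i, j} \<in> snd G}"
  have V: "finite (fst G)" and sub: "?P \<subseteq> fst G \<times> fst G"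
    using assms by (auto simp: simple_graph_def)
  have "finite ?P"
    by (rule finite_subset[OF sub finite_cartesian_product[OF V V]])
  moreover have "{x \<in> space ?M. x (fst p) + x (snd p) \<le> 1} \<in> sets ?M" if "p \<in> ?P" for p
  proof -
    have "fst p \<in> fst G" "snd p \<in> fst G"
      using that sub by auto
    then have [measurable]: "(\<lambda>x. x (fst p)) \<in> borel_measurable ?M"
      "(\<lambda>x. x (snd p)) \<in> borel_measurable ?M"
      using measurable_component_singleton[of _ "fst G" "\<lambda>_. lborel :: real measure"] by simp_all
    show ?thesis by measurable
  qed
  ultimately have "{x \<in> space ?M. \<forall>p \<in> ?P. x (fst p) + x (snd p) \<le> 1} \<in> sets ?M"
    by (intro sets.sets_Collect_finite_All) auto
  moreover have "(fst G \<rightarrow>\<^sub>E {0..1}) \<in> sets ?M"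
    using V by (intro sets_PiM_I_finite) auto
  ultimately have "(fst G \<rightarrow>\<^sub>E {0..1}) \<inter>
      {x \<in> space ?M. \<forall>p \<in> ?P. x (fst p) + x (snd p) \<le> 1} \<in> sets ?M"
    by blast
  also have "(fst G \<rightarrow>\<^sub>E {0..1}) \<inter>
      {x \<in> space ?M. \<forall>p \<in> ?P. x (fst p) + x (snd p) \<le> 1} = graph_polytope G"
    by (auto simp: graph_polytope_def space_PiM PiE_iff extensional_def)
  finally show ?thesis .
qed

end

(* Replacing x_i by 1 - x_i for even i preserves volume and turns the polytope of the path into
   the set of points y of the unit cube with y_1 <= y_2 >= y_3 <= ... . Up to the null set of points
   with two equal coordinates, the cube is the disjoint union of n! cells, one for each relative
   order of the coordinates; permuting coordinates shows that all cells have volume 1/n!, and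
   E_n of them make up the reflected polytope. For the generating function, the volume is refined
   by a bound t on the last coordinate, which by Fubini gives a recursion solved by
   trigonometric series. *)
theory Submission
  imports Defs
begin

section \<open>Order cells of the cube\<close>

text \<open>Boxes determine a product measure, and the preimage of a box is a box with permuted,
  pulled back sides, so the product of side measures is only reindexed. The lemma serves twice: with
  \<open>g\<close> the identity to permute coordinates, and with \<open>s\<close> the identity to
  reflect some of them.\<close>

lemma distr_PiM_permute:
  assumes "product_sigma_finite M" and I: "finite I" and s: "s permutes I"
    and g: "\<And>i. i \<in> I \<Longrightarrow> g i \<in> measurable (M (s i)) (M i)"
    and distr_g: "\<And>i. i \<in> I \<Longrightarrow> distr (M (s i)) (M i) (g i) = M i"
  shows "distr (PiM I M) (PiM I M) (\<lambda>x. \<lambda>i\<in>I. g i (x (s i))) = PiM I M"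
    and "(\<lambda>x. \<lambda>i\<in>I. g i (x (s i))) \<in> measurable (PiM I M) (PiM I M)"
proof -
  interpret product_sigma_finite M by fact
  let ?T = "\<lambda>x. \<lambda>i\<in>I. g i (x (s i))"
  have sI: "s i \<in> I \<longleftrightarrow> i \<in> I" for i
    using s by (rule permutes_in_image)
  show T: "?T \<in> measurable (PiM I M) (PiM I M)"
  proof (rule measurable_restrict)
    fix i assume "i \<in> I"
    then show "(\<lambda>x. g i (x (s i))) \<in> measurable (PiM I M) (M i)"
      using sI by (intro measurable_compose[of "\<lambda>x. x (s i)" _ "M (s i)" "g i"] measurable_component_singleton g) auto
  qed
  show "distr (PiM I M) (PiM I M) ?T = PiM I M"
  proof (rule PiM_eqI[OF I])
    fix A assume A: "\<And>i. i \<in> I \<Longrightarrow> A i \<in> sets (M i)"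
    \<comment> \<open>The sides of the preimage box: coordinate \<open>j\<close> of \<open>x\<close>
      ends up in position \<open>inv s j\<close>, so that side of the target constrains it.\<close>
    define B where "B j = g (inv s j) -` A (inv s j) \<inter> space (M j)" for j
    have B: "B (s i) = g i -` A i \<inter> space (M (s i))" for i
      using s by (simp add: B_def permutes_inverses)
    have B_sets: "B j \<in> sets (M j)" if "j \<in> I" for j
    proof -
      have "inv s j \<in> I" "s (inv s j) = j"
        using that s by (simp_all add: permutes_in_image permutes_inv permutes_inverses)
      then show ?thesis
        using measurable_sets[OF g[of "inv s j"] A[of "inv s j"]] by (simp add: B_def)
    qed
    have "?T -` Pi\<^sub>E I A \<inter> space (PiM I M) = Pi\<^sub>E I B"
    proof (intro set_eqI iffI)
      fix x assume x: "x \<in> ?T -` Pi\<^sub>E I A \<inter> space (PiM I M)"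
      then have *: "x (s i) \<in> B (s i)" if "i \<in> I" for i
        using that sI by (auto simp: B space_PiM PiE_iff)
      have "x j \<in> B j" if "j \<in> I" for j
        using *[of "inv s j"] that s by (simp add: permutes_in_image permutes_inv permutes_inverses)
      then show "x \<in> Pi\<^sub>E I B"
        using x by (auto simp: space_PiM PiE_iff)
    next
      fix x assume x: "x \<in> Pi\<^sub>E I B"
      then have "x (s i) \<in> B (s i)" if "i \<in> I" for i
        using that sI by auto
      moreover have "x j \<in> space (M j)" if "j \<in> I" for j
        using x that by (auto simp: B_def PiE_iff)
      ultimately show "x \<in> ?T -` Pi\<^sub>E I A \<inter> space (PiM I M)"
        using x by (auto simp: space_PiM PiE_iff B)
    qed
    then have "emeasure (distr (PiM I M) (PiM I M) ?T) (Pi\<^sub>E I A) = emeasure (PiM I M) (Pi\<^sub>E I B)"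
      using A by (subst emeasure_distr[OF T]) (auto intro!: sets_PiM_I_finite I)
    also have "\<dots> = (\<Prod>j\<in>I. emeasure (M j) (B j))"
      by (rule emeasure_PiM[OF I B_sets])
    also have "\<dots> = (\<Prod>i\<in>I. emeasure (M (s i)) (B (s i)))"
      by (rule prod.permute[OF s, unfolded o_def])
    also have "\<dots> = (\<Prod>i\<in>I. emeasure (distr (M (s i)) (M i) (g i)) (A i))"
      using A g by (intro prod.cong refl) (simp add: emeasure_distr B)
    also have "\<dots> = (\<Prod>i\<in>I. emeasure (M i) (A i))"
      by (intro prod.cong refl) (simp add: distr_g)
    finally show "emeasure (distr (PiM I M) (PiM I M) ?T) (Pi\<^sub>E I A) = \<dots>" .
  qed simp
qed

interpretation PiM_lborel: product_sigma_finite "\<lambda>_. lborel :: real measure"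
  by standard

text \<open>By Fubini: once the other coordinates are fixed, a tie confines \<open>x i\<close> to
  the single point \<open>x j\<close>, and there are only finitely many pairs.\<close>

lemma AE_PiM_lborel_inj_on:
  assumes "finite I"
  shows "AE x in PiM I (\<lambda>_. lborel :: real measure). inj_on x I"
proof -
  have "AE x in PiM I (\<lambda>_. lborel :: real measure). x i \<noteq> x j"
    if ij: "i \<in> I" "j \<in> I" "i \<noteq> j" for i j
  proof -
    let ?J = "I - {i}" and ?M = "\<lambda>_. lborel :: real measure"
    have I: "I = insert i ?J" "finite ?J" "i \<notin> ?J" and j: "j \<in> ?J"
      using assms ij by auto
    have [measurable]: "(\<lambda>x. x i) \<in> borel_measurable (PiM I ?M)"
      "(\<lambda>x. x j) \<in> borel_measurable (PiM I ?M)"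
      using ij measurable_component_singleton[of _ I ?M] by simp_all
    have N: "{x \<in> space (PiM I ?M). x i = x j} \<in> sets (PiM I ?M)"
      by measurable
    have "emeasure (PiM I ?M) {x \<in> space (PiM I ?M). x i = x j}
        = (\<integral>\<^sup>+x. indicator {x \<in> space (PiM I ?M). x i = x j} x \<partial>PiM (insert i ?J) ?M)"
      using N I(1) by simp
    also have "\<dots> = (\<integral>\<^sup>+x. (\<integral>\<^sup>+y. indicator {x \<in> space (PiM I ?M). x i = x j} (x(i := y)) \<partial>lborel) \<partial>PiM ?J ?M)"
      using N I by (intro PiM_lborel.product_nn_integral_insert) auto
    also have "\<dots> \<le> (\<integral>\<^sup>+x. (\<integral>\<^sup>+y. indicator {x j} y \<partial>lborel) \<partial>PiM ?J ?M)"
      using j by (intro nn_integral_mono) (auto split: split_indicator)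
    also have "\<dots> = 0"
      by simp
    finally show ?thesis
      using N by (intro AE_I[of _ _ "{x \<in> space (PiM I ?M). x i = x j}"]) auto
  qed
  then have "AE x in PiM I (\<lambda>_. lborel :: real measure).
      \<forall>i\<in>I. \<forall>j\<in>I. i \<noteq> j \<longrightarrow> x i \<noteq> x j"
    using assms by (intro AE_finite_allI) auto
  then show ?thesis
    by (auto simp: inj_on_def)
qed

text \<open>For a permutation, \<open>a i\<close> is the rank of \<open>x i\<close>. Strict
  inequalities keep the cells disjoint; points with ties lie in none of them.\<close>

definition order_cell :: "nat \<Rightarrow> (nat \<Rightarrow> nat) \<Rightarrow> (nat \<Rightarrow> real) set" where
  "order_cell n a = {x \<in> {1..n} \<rightarrow>\<^sub>E {0..1}. \<forall>i\<in>{1..n}. \<forall>j\<in>{1..n}. a i < a j \<longrightarrow> x i < x j}"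

lemma sets_order_cell: "order_cell n a \<in> sets (PiM {1..n} (\<lambda>_. lborel))"
proof -
  let ?M = "PiM {1..n} (\<lambda>_. lborel :: real measure)"
  have "{x \<in> space ?M. \<forall>i\<in>{1..n}. \<forall>j\<in>{1..n}. a i < a j \<longrightarrow> x i < x j} \<in> sets ?M"
  proof (intro sets.sets_Collect_finite_All finite_atLeastAtMost)
    fix i j assume "i \<in> {1..n}" "j \<in> {1..n}"
    then have [measurable]: "(\<lambda>x. x i) \<in> borel_measurable ?M" "(\<lambda>x. x j) \<in> borel_measurable ?M"
      using measurable_component_singleton[of _ "{1..n}" "\<lambda>_. lborel :: real measure"] by simp_all
    show "{x \<in> space ?M. a i < a j \<longrightarrow> x i < x j} \<in> sets ?M"
      by measurable
  qed
  moreover have "({1..n} \<rightarrow>\<^sub>E {0..1}) \<in> sets ?M"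
    by (intro sets_PiM_I_finite) auto
  ultimately have "({1..n} \<rightarrow>\<^sub>E {0..1}) \<inter>
      {x \<in> space ?M. \<forall>i\<in>{1..n}. \<forall>j\<in>{1..n}. a i < a j \<longrightarrow> x i < x j} \<in> sets ?M"
    by blast
  also have "({1..n} \<rightarrow>\<^sub>E {0..1}) \<inter>
      {x \<in> space ?M. \<forall>i\<in>{1..n}. \<forall>j\<in>{1..n}. a i < a j \<longrightarrow> x i < x j} = order_cell n a"
    by (auto simp: order_cell_def space_PiM PiE_iff extensional_def)
  finally show ?thesis .
qed

lemma order_cell_less_iff:
  assumes "x \<in> order_cell n a" "a permutes {1..n}" "i \<in> {1..n}" "j \<in> {1..n}"
  shows "x i < x j \<longleftrightarrow> a i < a j"
proof -
  have "a i < a j \<Longrightarrow> x i < x j" "a j < a i \<Longrightarrow> x j < x i" "a i = a j \<Longrightarrow> i = j"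
    using assms permutes_inj[OF assms(2), THEN injD, of i j] by (simp_all add: order_cell_def)
  then show ?thesis
    by (metis linorder_neq_iff order_less_asym)
qed

text \<open>Surjectivity makes the values up to \<open>a i\<close> exactly 1, ...,
  \<open>a i\<close>. Hence a permutation can be recovered from the order it induces on the
  indices.\<close>

lemma permutes_eq_card:
  fixes a :: "nat \<Rightarrow> nat"
  assumes a: "a permutes {1..n}" and i: "i \<in> {1..n}"
  shows "a i = card {j \<in> {1..n}. a j \<le> a i}"
proof -
  have "a ` {j \<in> {1..n}. a j \<le> a i} = {k \<in> a ` {1..n}. k \<le> a i}"
    by blast
  also have "\<dots> = {1..a i}"
    using permutes_in_image[OF a, of i] i unfolding permutes_image[OF a] by auto
  finally have "card (a ` {j \<in> {1..n}. a j \<le> a i}) = a i"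
    by simp
  then show ?thesis
    by (simp add: card_image[OF permutes_inj_on[OF a]])
qed

text \<open>A common point forces both permutations to order the indices in the same way, and
  \<open>permutes_eq_card\<close> then identifies them.\<close>

lemma disjoint_order_cell: "disjoint_family_on (order_cell n) {a. a permutes {1..n}}"
unfolding disjoint_family_on_def
proof (intro ballI impI)
  fix a b assume ab: "a \<in> {a. a permutes {1..n}}" "b \<in> {a. a permutes {1..n}}" "a \<noteq> b"
  have False if x: "x \<in> order_cell n a" "x \<in> order_cell n b" for x
  proof -
    have "a i = b i" for i
    proof (cases "i \<in> {1..n}")
      case True
      have "{j \<in> {1..n}. a j \<le> a i} = {j \<in> {1..n}. b j \<le> b i}"
        using order_cell_less_iff[OF x(1), of i] order_cell_less_iff[OF x(2), of i] ab True
        by (auto simp: not_less[symmetric])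
      then show ?thesis
        using permutes_eq_card[of a n i] permutes_eq_card[of b n i] ab True by simp
    next
      case False
      then show ?thesis
        using ab by (simp add: permutes_not_in)
    qed
    then show False
      using ab by auto
  qed
  then show "order_cell n a \<inter> order_cell n b = {}"
    by blast
qed

lemma ex_order_cell:
  assumes x: "x \<in> {1..n} \<rightarrow>\<^sub>E {0..1}" and inj: "inj_on x {1..n}"
  obtains a where "a permutes {1..n}" "x \<in> order_cell n a"
proof
  \<comment> \<open>The rank of \<open>x i\<close> among the coordinates, extended by the identity
    as \<open>permutes\<close> demands.\<close>
  define a where "a i = (if i \<in> {1..n} then card {j \<in> {1..n}. x j \<le> x i} else i)" for i
  have less: "a i < a j" if "i \<in> {1..n}" "j \<in> {1..n}" "x i < x j" for i j
  proof -
    have "{k \<in> {1..n}. x k \<le> x i} \<subseteq> {k \<in> {1..n}. x k \<le> x j}"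
      "j \<in> {k \<in> {1..n}. x k \<le> x j}" "j \<notin> {k \<in> {1..n}. x k \<le> x i}"
      using that by auto
    then have "{k \<in> {1..n}. x k \<le> x i} \<subset> {k \<in> {1..n}. x k \<le> x j}"
      by blast
    then show ?thesis
      using that psubset_card_mono[of "{k \<in> {1..n}. x k \<le> x j}" "{k \<in> {1..n}. x k \<le> x i}"]
      by (simp add: a_def)
  qed
  have "a ` {1..n} \<subseteq> {1..n}"
  proof
    fix k assume "k \<in> a ` {1..n}"
    then obtain i where i: "i \<in> {1..n}" "k = card {j \<in> {1..n}. x j \<le> x i}"
      by (auto simp: a_def)
    have "card {i} \<le> k"
      unfolding i(2) using i(1) by (intro card_mono) auto
    moreover have "k \<le> card {1..n}"
      unfolding i(2) by (intro card_mono) auto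
    ultimately show "k \<in> {1..n}"
      by simp
  qed
  moreover have "inj_on a {1..n}"
    using less inj by (metis (no_types, lifting) inj_onI inj_onD linorder_neq_iff less_irrefl)
  ultimately have "bij_betw a {1..n} {1..n}"
    by (simp add: bij_betw_def endo_inj_surj)
  then show "a permutes {1..n}"
    by (rule bij_imp_permutes) (auto simp: a_def)
  show "x \<in> order_cell n a"
    using x less inj unfolding order_cell_def
    by (auto simp: not_less) (metis inj_onD atLeastAtMost_iff linorder_neq_iff not_less_iff_gr_or_eq)
qed

text \<open>Relabelling moves \<open>x i\<close> to position \<open>a i\<close>, so it pulls the
  identity cell back to the cell of \<open>a\<close>, and it preserves volume by
  \<open>distr_PiM_permute\<close>.\<close>

lemma emeasure_order_cell_eq:
  assumes a: "a permutes {1..n}"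
  shows "emeasure (PiM {1..n} (\<lambda>_. lborel)) (order_cell n a)
       = emeasure (PiM {1..n} (\<lambda>_. lborel)) (order_cell n id)"
proof -
  let ?M = "PiM {1..n} (\<lambda>_. lborel :: real measure)"
  let ?T = "\<lambda>x. \<lambda>i\<in>{1..n}. x (inv a i) :: real"
  have T: "distr ?M ?M ?T = ?M" "?T \<in> measurable ?M ?M"
    by (rule distr_PiM_permute[where g = "\<lambda>_ x. x",
          OF PiM_lborel.product_sigma_finite_axioms finite_atLeastAtMost permutes_inv[OF a]];
        simp add: distr_id2)+
  have inv: "inv a i \<in> {1..n}" "a i \<in> {1..n}" if "i \<in> {1..n}" for i
    using that permutes_in_image[OF a] permutes_in_image[OF permutes_inv[OF a]] by blast+
  have "?T -` order_cell n id \<inter> space ?M = order_cell n a"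
  proof (intro set_eqI iffI)
    fix x assume x: "x \<in> ?T -` order_cell n id \<inter> space ?M"
    then have ext: "x \<in> extensional {1..n}"
      by (simp add: space_PiM PiE_iff)
    have Tx: "?T x (a i) = x i" if "i \<in> {1..n}" for i
      using inv(2)[OF that] a by (simp add: permutes_inverses)
    have cell: "?T x \<in> order_cell n id"
      using x by simp
    have "x i \<in> {0..1}" if "i \<in> {1..n}" for i
      using cell inv(2)[OF that] Tx[OF that] unfolding order_cell_def PiE_iff by fastforce
    moreover have "x i < x j" if "i \<in> {1..n}" "j \<in> {1..n}" "a i < a j" for i j
      using cell inv(2)[OF that(1)] inv(2)[OF that(2)] Tx[OF that(1)] Tx[OF that(2)] that(3)
      unfolding order_cell_def by (metis (mono_tags, lifting) id_apply mem_Collect_eq)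
    ultimately show "x \<in> order_cell n a"
      using ext by (auto simp: order_cell_def PiE_iff)
  next
    fix x assume x: "x \<in> order_cell n a"
    have "?T x \<in> order_cell n id"
      using x inv a unfolding order_cell_def PiE_iff by (auto simp: permutes_inverses)
    then show "x \<in> ?T -` order_cell n id \<inter> space ?M"
      using x by (simp add: order_cell_def space_PiM PiE_iff)
  qed
  then show ?thesis
    using emeasure_distr[OF T(2) sets_order_cell[of n id]] T(1) by simp
qed

lemma emeasure_eq_sum_order_cell:
  assumes B: "B \<in> sets (PiM {1..n} (\<lambda>_. lborel))" "B \<subseteq> {1..n} \<rightarrow>\<^sub>E {0..1}"
  shows "emeasure (PiM {1..n} (\<lambda>_. lborel)) B
       = (\<Sum>a | a permutes {1..n}. emeasure (PiM {1..n} (\<lambda>_. lborel)) (B \<inter> order_cell n a))"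
proof -
  let ?M = "PiM {1..n} (\<lambda>_. lborel :: real measure)"
  let ?P = "{a. a permutes {1..n}}"
  have fin: "finite ?P"
    by (simp add: finite_permutations)
  have sets: "B \<inter> order_cell n a \<in> sets ?M" for a
    using B sets_order_cell by blast
  have "emeasure ?M B = emeasure ?M (\<Union>a\<in>?P. B \<inter> order_cell n a)"
  proof (rule emeasure_eq_AE)
    show "AE x in ?M. x \<in> B \<longleftrightarrow> x \<in> (\<Union>a\<in>?P. B \<inter> order_cell n a)"
      using AE_PiM_lborel_inj_on[OF finite_atLeastAtMost]
    proof eventually_elim
      case (elim x)
      have "\<exists>a\<in>?P. x \<in> order_cell n a" if "x \<in> B"
        using ex_order_cell[OF subsetD[OF B(2) that] elim] by (metis mem_Collect_eq)
      then show ?case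
        by auto
    qed
    show "(\<Union>a\<in>?P. B \<inter> order_cell n a) \<in> sets ?M"
      using fin sets by (intro sets.finite_UN) auto
  qed fact
  also have "\<dots> = (\<Sum>a\<in>?P. emeasure ?M (B \<inter> order_cell n a))"
    using fin sets disjoint_order_cell[of n]
    by (intro sum_emeasure[symmetric]) (auto simp: disjoint_family_on_def)
  finally show ?thesis .
qed

lemma emeasure_order_cell:
  assumes "a permutes {1..n}"
  shows "emeasure (PiM {1..n} (\<lambda>_. lborel)) (order_cell n a) = ennreal (1 / fact n)"
proof -
  let ?M = "PiM {1..n} (\<lambda>_. lborel :: real measure)"
  let ?C = "{1..n} \<rightarrow>\<^sub>E {0..1::real}"
  let ?s = "emeasure ?M (order_cell n a)"
  have C: "?C \<in> sets ?M"
    by (intro sets_PiM_I_finite) auto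
  have "1 = emeasure ?M ?C"
    by (simp add: PiM_lborel.emeasure_PiM)
  also have "\<dots> = (\<Sum>b | b permutes {1..n}. ?s)"
    unfolding emeasure_eq_sum_order_cell[OF C order_refl]
  proof (intro sum.cong refl)
    fix b assume "b \<in> {b. b permutes {1..n}}"
    moreover have "?C \<inter> order_cell n b = order_cell n b"
      by (auto simp: order_cell_def)
    ultimately show "emeasure ?M (?C \<inter> order_cell n b) = ?s"
      using emeasure_order_cell_eq[of b n] emeasure_order_cell_eq[OF assms] by simp
  qed
  also have "\<dots> = ennreal (fact n) * ?s"
    by (simp add: card_permutations ennreal_of_nat_eq_real_of_nat)
  finally have *: "ennreal (fact n) * ?s = 1" ..
  \<comment> \<open>Both \<open>?s\<close> and the claimed value are multiplicative inverses of
    \<open>fact n\<close>, hence equal.\<close>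
  moreover have "ennreal (1 / fact n) * ennreal (fact n) = 1"
    by (simp flip: ennreal_mult)
  ultimately show ?thesis
    by (metis mult.assoc mult.left_neutral mult.right_neutral)
qed

section \<open>Reflecting the even coordinates\<close>

text \<open>The order polytope of the zigzag poset.\<close>

definition alternating_polytope :: "nat \<Rightarrow> (nat \<Rightarrow> real) set" where
  "alternating_polytope n = {y \<in> {1..n} \<rightarrow>\<^sub>E {0..1}.
     \<forall>i\<in>{1..n - 1}. if odd i then y i \<le> y (i + 1) else y (i + 1) \<le> y i}"

definition reflect_even :: "nat \<Rightarrow> (nat \<Rightarrow> real) \<Rightarrow> nat \<Rightarrow> real" where
  "reflect_even n x = (\<lambda>i\<in>{1..n}. if even i then 1 - x i else x i)"

lemma distr_reflect_even:
  "distr (PiM {1..n} (\<lambda>_. lborel)) (PiM {1..n} (\<lambda>_. lborel)) (reflect_even n) = PiM {1..n} (\<lambda>_. lborel)"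
  "reflect_even n \<in> measurable (PiM {1..n} (\<lambda>_. lborel)) (PiM {1..n} (\<lambda>_. lborel))"
proof -
  let ?g = "\<lambda>i t. if even i then 1 - t else t :: real"
  have "distr lborel lborel (\<lambda>t::real. 1 - t) = distr lborel borel (\<lambda>t. 1 - t)"
    by (rule distr_cong) auto
  also have "\<dots> = lborel"
    \<comment> \<open>Slope -1 has absolute value 1, so the density factor of the affine change of
      variables disappears.\<close>
    using lborel_real_affine[of "-1" 1] by (simp add: density_1 flip: one_ennreal_def)
  finally have "distr lborel lborel (?g i) = lborel" "?g i \<in> measurable lborel lborel" for i :: nat
    by (cases "even i"; simp add: distr_id2)+
  then show "distr (PiM {1..n} (\<lambda>_. lborel)) (PiM {1..n} (\<lambda>_. lborel)) (reflect_even n)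
      = PiM {1..n} (\<lambda>_. lborel)"
    "reflect_even n \<in> measurable (PiM {1..n} (\<lambda>_. lborel)) (PiM {1..n} (\<lambda>_. lborel))"
    using distr_PiM_permute[OF PiM_lborel.product_sigma_finite_axioms finite_atLeastAtMost[of 1 n]
        permutes_id, of ?g]
    unfolding reflect_even_def[abs_def] id_apply by blast+
qed

lemma graph_polytope_path_graph:
  "graph_polytope (path_graph n) =
     {x \<in> {1..n} \<rightarrow>\<^sub>E {0..1}. \<forall>i\<in>{1..n - 1}. x i + x (i + 1) \<le> 1}"
proof -
  have "(\<forall>i j. {i, j} \<in> {{k, k + 1} | k. k \<in> {1..n - 1}} \<longrightarrow> x i + x j \<le> 1) \<longleftrightarrow>
      (\<forall>k\<in>{1..n - 1}. x k + x (k + 1) \<le> 1)" for x :: "nat \<Rightarrow> real"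
  proof (intro iffI ballI allI impI)
    fix k assume "\<forall>i j. {i, j} \<in> {{k, k + 1} | k. k \<in> {1..n - 1}} \<longrightarrow> x i + x j \<le> 1"
      "k \<in> {1..n - 1}"
    then show "x k + x (k + 1) \<le> 1"
      by blast
  next
    fix i j assume *: "\<forall>k\<in>{1..n - 1}. x k + x (k + 1) \<le> 1"
      "{i, j} \<in> {{k, k + 1} | k. k \<in> {1..n - 1}}"
    then obtain k where "{i, j} = {k, k + 1}" "k \<in> {1..n - 1}"
      by blast
    then show "x i + x j \<le> 1"
      using bspec[OF *(1), of k] by (auto simp: doubleton_eq_iff add.commute)
  qed
  then show ?thesis
    by (simp add: graph_polytope_def path_graph_def)
qed

text \<open>Each edge has exactly one even endpoint, so after reflection its sum constraint compares
  the two coordinates, in a direction given by the parity of \<open>i\<close>.\<close>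

lemma vimage_reflect_even:
  "reflect_even n -` graph_polytope (path_graph n) \<inter> space (PiM {1..n} (\<lambda>_. lborel))
   = alternating_polytope n"
proof -
  \<comment> \<open>The reflected point does not see values of \<open>x\<close> outside the index
    set; extensionality comes back from the intersection with the space.\<close>
  have cube: "(reflect_even n x \<in> {1..n} \<rightarrow>\<^sub>E {0..1}) \<longleftrightarrow> (\<forall>i\<in>{1..n}. x i \<in> {0..1})" for x
    by (auto simp: reflect_even_def PiE_iff split: if_splits)
  have edge: "reflect_even n x i + reflect_even n x (i + 1) \<le> 1 \<longleftrightarrow>
      (if odd i then x i \<le> x (i + 1) else x (i + 1) \<le> x i)" if "i \<in> {1..n - 1}" for x i
    using that by (auto simp: reflect_even_def)
  have "(\<forall>i\<in>{1..n - 1}. reflect_even n x i + reflect_even n x (i + 1) \<le> 1) \<longleftrightarrow>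
      (\<forall>i\<in>{1..n - 1}. if odd i then x i \<le> x (i + 1) else x (i + 1) \<le> x i)" for x
    by (rule ball_cong[OF refl edge])
  then show ?thesis
    unfolding graph_polytope_path_graph alternating_polytope_def space_PiM vimage_def Int_def
      mem_Collect_eq cube unfolding PiE_iff by (intro Collect_cong) (simp only:, simp, blast)
qed

lemma graph_vol_path_graph_euler:
  assumes "n \<ge> 1"
  shows "graph_vol (path_graph n) = real (euler_number n) / fact n"
proof -
  let ?M = "PiM {1..n} (\<lambda>_. lborel :: real measure)"
  let ?A = "alternating_polytope n"
  let ?alt = "\<lambda>a :: nat \<Rightarrow> nat. \<forall>i\<in>{1..n - 1}. if odd i then a i < a (i + 1) else a i > a (i + 1)"
  have P: "graph_polytope (path_graph n) \<in> sets ?M"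
    using sets_graph_polytope[OF simple_graph_path_graph[of n]] by (simp add: path_graph_def)
  have A: "?A \<in> sets ?M"
    using measurable_sets[OF distr_reflect_even(2) P] unfolding vimage_reflect_even .
  have "emeasure ?M (graph_polytope (path_graph n)) = emeasure ?M ?A"
    using emeasure_distr[OF distr_reflect_even(2) P]
    unfolding vimage_reflect_even distr_reflect_even(1) .
  also have "\<dots> = (\<Sum>a | a permutes {1..n}. emeasure ?M (?A \<inter> order_cell n a))"
    by (rule emeasure_eq_sum_order_cell[OF A]) (auto simp: alternating_polytope_def)
  also have "\<dots> = (\<Sum>a | a permutes {1..n}. if ?alt a then ennreal (1 / fact n) else 0)"
  proof (intro sum.cong refl)
    fix a assume "a \<in> {a. a permutes {1..n}}"
    then have a: "a permutes {1..n}" by simp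
    \<comment> \<open>A cell lies inside \<open>?A\<close> or misses it: neighbouring coordinates
      differ on the cell, so weak comparisons of \<open>x\<close> agree with strict ones of
      \<open>a\<close>.\<close>
    have mem: "x \<in> ?A \<longleftrightarrow> ?alt a" if x: "x \<in> order_cell n a" for x
    proof -
      have "(if odd i then x i \<le> x (i + 1) else x (i + 1) \<le> x i) \<longleftrightarrow>
          (if odd i then a i < a (i + 1) else a i > a (i + 1))" if "i \<in> {1..n - 1}" for i
      proof -
        have i: "i \<in> {1..n}" "i + 1 \<in> {1..n}"
          using that by auto
        have "a i \<noteq> a (i + 1)"
          using inj_eq[OF permutes_inj[OF a], of i "i + 1"] by simp
        then show ?thesis
          using order_cell_less_iff[OF x a i] order_cell_less_iff[OF x a i(2,1)] by auto
      qed
      moreover have "x \<in> {1..n} \<rightarrow>\<^sub>E {0..1}"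
        using x by (simp add: order_cell_def)
      ultimately show ?thesis
        by (simp add: alternating_polytope_def)
    qed
    show "emeasure ?M (?A \<inter> order_cell n a) = (if ?alt a then ennreal (1 / fact n) else 0)"
    proof (cases "?alt a")
      case True
      then have "?A \<inter> order_cell n a = order_cell n a"
        using mem by blast
      then show ?thesis
        unfolding if_P[OF True] using emeasure_order_cell[OF a] by simp
    next
      case False
      then have "?A \<inter> order_cell n a = {}"
        using mem by blast
      then show ?thesis
        unfolding if_not_P[OF False] by simp
    qed
  qed
  also have "\<dots> = (\<Sum>a | a permutes {1..n} \<and> ?alt a. ennreal (1 / fact n))"
    by (subst sum.inter_filter[symmetric]) (simp_all add: finite_permutations)
  also have "\<dots> = of_nat (euler_number n) * ennreal (1 / fact n)"
    using assms by (simp add: euler_number_def)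
  also have "\<dots> = ennreal (real (euler_number n) / fact n)"
    by (simp add: ennreal_of_nat_eq_real_of_nat flip: ennreal_mult)
  finally show ?thesis
    by (simp add: graph_vol_def measure_def path_graph_def)
qed

section \<open>The generating function\<close>

definition sec_tan_fps :: "real fps" where
  "sec_tan_fps = inverse (fps_cos 1) + fps_tan 1"

lemma has_fps_expansion_sec_tan: "(\<lambda>x::real. 1 / cos x + tan x) has_fps_expansion sec_tan_fps"
  unfolding sec_tan_fps_def inverse_eq_divide[symmetric]
  by (intro fps_expansion_intros) simp

lemma sec_tan_fps_times_cos: "sec_tan_fps * fps_cos 1 = 1 + fps_sin 1"
proof -
  have "fps_nth (fps_cos (1::real)) 0 \<noteq> 0" by simp
  then show ?thesis
    by (simp add: sec_tan_fps_def fps_tan_def fps_divide_unit inverse_mult_eq_1 distrib_right mult.assoc)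
qed

text \<open>With \<open>F\<^sub>n(t)\<close> the volume of the part of the polytope of \<open>L\<^sub>n\<close> where the last coordinate is
  at most \<open>t\<close>, the series \<open>F(t) = \<Sum>n. F\<^sub>n(t) x^n\<close> satisfies \<open>F' (t) = x F(1 - t)\<close> and \<open>F(0) = 1\<close>,
  so \<open>F'' = -x^2 F\<close> and \<open>F(t) = cos (x t) + F(1) sin (x t)\<close>; putting \<open>t = 1\<close> gives
  \<open>F(1) = sec x + tan x\<close>.\<close>

definition path_fps :: "real \<Rightarrow> real fps" where
  "path_fps t = fps_cos t + sec_tan_fps * fps_sin t"

lemma path_fps_0 [simp]: "path_fps 0 = 1"
  by (simp add: path_fps_def)

lemma path_fps_nth_0 [simp]: "fps_nth (path_fps t) 0 = 1"
  by (simp add: path_fps_def)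

text \<open>The addition formulas give cos(xt) the coefficient cos x + E sin x = E and sin(xt) the
  coefficient sin x - E cos x = -1, where E = sec x + tan x. In this form the derivative of
  \<open>path_fps\<close> can be compared term by term.\<close>

lemma path_fps_reflect: "path_fps (1 - t) = sec_tan_fps * fps_cos t - fps_sin t"
proof -
  let ?c = "fps_cos (1::real)" and ?s = "fps_sin (1::real)" and ?E = sec_tan_fps
  have c: "?c \<noteq> 0"
    by (metis fps_cos_nth_0 fps_zero_nth zero_neq_one)
  have *: "?E * ?c = 1 + ?s" by (rule sec_tan_fps_times_cos)
  \<comment> \<open>Multiplying by the cosine series makes \<open>?E\<close> occur only in
    \<open>?E * ?c\<close>, which is known; the factor is cancelled at the end.\<close>
  have "?c * (?c + ?E * ?s) = ?c\<^sup>2 + (?E * ?c) * ?s"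
    by (simp add: algebra_simps power2_eq_square)
  also have "\<dots> = 1 + ?s"
    using fps_sin_cos_sum_of_squares[of "1::real"] by (simp add: * algebra_simps power2_eq_square)
  also have "\<dots> = ?c * ?E"
    using * by (simp add: mult.commute)
  finally have E: "?c + ?E * ?s = ?E"
    using c by simp
  have cos_diff: "fps_cos (1 - t) = ?c * fps_cos t + ?s * fps_sin t"
    and sin_diff: "fps_sin (1 - t) = ?s * fps_cos t - ?c * fps_sin t"
    using fps_cos_add[of 1 "-t"] fps_sin_add[of 1 "-t"] by (simp_all add: fps_sin_even fps_cos_odd)
  have "path_fps (1 - t) = (?c + ?E * ?s) * fps_cos t + (?s - ?E * ?c) * fps_sin t"
    unfolding path_fps_def cos_diff sin_diff by (simp add: algebra_simps)
  then show ?thesis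
    unfolding E * by simp
qed

lemma path_fps_1: "path_fps 1 = sec_tan_fps"
  using path_fps_reflect[of 0] by simp

text \<open>As a function of \<open>t\<close>, each coefficient is a monomial over a factorial. The
  index shift encodes the factor x in d/dt sin(xt) = x cos(xt) and d/dt cos(xt) = -x
  sin(xt).\<close>

lemma DERIV_fps_sin_nth:
  "((\<lambda>t. fps_nth (fps_sin t) (Suc n)) has_real_derivative fps_nth (fps_cos t) n) (at t)"
  "((\<lambda>t. fps_nth (fps_cos t) (Suc n)) has_real_derivative - (fps_nth (fps_sin t) n)) (at t)"
proof -
  have monom: "((\<lambda>t. c * t ^ Suc n / fact (Suc n)) has_real_derivative c * t ^ n / fact n) (at t)" for c :: real
    by (rule derivative_eq_intros refl | simp)+
  show "((\<lambda>t. fps_nth (fps_sin t) (Suc n)) has_real_derivative fps_nth (fps_cos t) n) (at t)"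
    using monom[of "(- 1) ^ (n div 2)"] by (cases "even n") (simp_all add: fps_sin_def fps_cos_def del: power_Suc fact_Suc)
  show "((\<lambda>t. fps_nth (fps_cos t) (Suc n)) has_real_derivative - (fps_nth (fps_sin t) n)) (at t)"
  proof (cases "even n")
    case False
    then have "(- 1) ^ (Suc n div 2) = - ((- 1) ^ (n div 2) :: real)" "(n - 1) div 2 = n div 2"
      by (auto elim!: oddE)
    then show ?thesis
      using monom[of "- ((- 1) ^ (n div 2))"] False
      by (simp add: fps_sin_def fps_cos_def del: power_Suc fact_Suc)
  qed (simp add: fps_sin_def fps_cos_def)
qed

text \<open>Coefficientwise form of F'(t) = x F(1 - t).\<close>

lemma DERIV_path_fps_nth:
  "((\<lambda>t. fps_nth (path_fps t) (Suc n)) has_real_derivative fps_nth (path_fps (1 - t)) n) (at t)"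
proof -
  \<comment> \<open>The last term of the Cauchy product drops out because the sine series has no
    constant term.\<close>
  have "fps_nth (path_fps t) (Suc n) = fps_nth (fps_cos t) (Suc n) + (\<Sum>i=0..n. fps_nth sec_tan_fps i * fps_nth (fps_sin t) (Suc (n - i)))" for t
    by (simp add: path_fps_def fps_mult_nth Suc_diff_le)
  moreover have "fps_nth (path_fps (1 - t)) n
      = - fps_nth (fps_sin t) n + (\<Sum>i=0..n. fps_nth sec_tan_fps i * fps_nth (fps_cos t) (n - i))"
    by (simp add: path_fps_reflect fps_mult_nth)
  moreover have "((\<lambda>t. fps_nth (fps_cos t) (Suc n)
        + (\<Sum>i=0..n. fps_nth sec_tan_fps i * fps_nth (fps_sin t) (Suc (n - i)))) has_real_derivative
      - fps_nth (fps_sin t) n + (\<Sum>i=0..n. fps_nth sec_tan_fps i * fps_nth (fps_cos t) (n - i))) (at t)"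
    by (intro DERIV_add DERIV_sum DERIV_cmult DERIV_fps_sin_nth)
  ultimately show ?thesis
    by (simp only:)
qed

section \<open>Volumes of slices of the path polytope\<close>

definition path_slice :: "nat \<Rightarrow> real \<Rightarrow> (nat \<Rightarrow> real) set" where
  "path_slice n t = {x \<in> graph_polytope (path_graph n). n \<noteq> 0 \<longrightarrow> x n \<le> t}"

lemma sets_path_slice: "path_slice n t \<in> sets (PiM {1..n} (\<lambda>_. lborel))"
proof -
  let ?M = "PiM {1..n} (\<lambda>_. lborel :: real measure)"
  have P: "graph_polytope (path_graph n) \<in> sets ?M"
    using sets_graph_polytope[OF simple_graph_path_graph[of n]] by (simp add: path_graph_def)
  show ?thesis
  proof (cases "n = 0")
    case True
    then show ?thesis
      using P by (simp add: path_slice_def)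
  next
    case False
    then have [measurable]: "(\<lambda>x. x n) \<in> borel_measurable ?M"
      using measurable_component_singleton[of n "{1..n}" "\<lambda>_. lborel :: real measure"] by simp
    have "{x \<in> space ?M. x n \<le> t} \<in> sets ?M"
      by measurable
    with P have "graph_polytope (path_graph n) \<inter> {x \<in> space ?M. x n \<le> t} \<in> sets ?M"
      by blast
    also have "graph_polytope (path_graph n) \<inter> {x \<in> space ?M. x n \<le> t} = path_slice n t"
      using False sets.sets_into_space[OF P] by (auto simp: path_slice_def)
    finally show ?thesis .
  qed
qed

text \<open>The new edge demands \<open>x n \<le> 1 - y\<close>, again a bound on a last coordinate;
  this is where F(1 - t) comes from. For \<open>n = 0\<close> there is no such edge, in line with
  the guard in \<open>path_slice\<close>.\<close>

lemma path_slice_Suc_iff: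
  assumes "x \<in> extensional {1..n}" "t \<in> {0..1}"
  shows "x(Suc n := y) \<in> path_slice (Suc n) t \<longleftrightarrow> y \<in> {0..t} \<and> x \<in> path_slice n (1 - y)"
proof -
  have "(\<forall>i\<in>{1..n}. (x(Suc n := y)) i + (x(Suc n := y)) (i + 1) \<le> 1) \<longleftrightarrow>
      (\<forall>i\<in>{1..n - 1}. x i + x (i + 1) \<le> 1) \<and> (n \<noteq> 0 \<longrightarrow> x n \<le> 1 - y)"
  proof (cases n)
    case (Suc m)
    then have "{1..n} = insert n {1..n - 1}"
      by auto
    then show ?thesis
      using Suc by (auto simp: algebra_simps)
  qed simp
  moreover have "x(Suc n := y) \<in> {1..Suc n} \<rightarrow>\<^sub>E {0..1} \<longleftrightarrow> x \<in> {1..n} \<rightarrow>\<^sub>E {0..1} \<and> y \<in> {0..1}"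
    using assms(1) by (auto simp: PiE_iff extensional_def atLeastAtMostSuc_conv)
  ultimately show ?thesis
    using assms(2) by (auto simp: path_slice_def graph_polytope_path_graph)
qed

text \<open>Induction with \<open>t\<close> general, as the step uses all bounds
  \<open>1 - y\<close>. Nonnegativity is carried along because \<open>ennreal\<close> sends negative
  numbers to 0 and the integrand must be nonnegative.\<close>

lemma emeasure_path_slice:
  assumes "t \<in> {0..1}"
  shows "0 \<le> fps_nth (path_fps t) n \<and> emeasure (PiM {1..n} (\<lambda>_. lborel)) (path_slice n t) = ennreal (fps_nth (path_fps t) n)"
  using assms
proof (induction n arbitrary: t)
  case 0
  \<comment> \<open>The product over no coordinates is a unit mass at the one function that is
    undefined everywhere.\<close>
  have "path_slice 0 t = {\<lambda>_. undefined}"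
    by (auto simp: path_slice_def graph_polytope_path_graph)
  then show ?case
    by (simp add: PiM_empty)
next
  case (Suc n)
  let ?M = "\<lambda>n. PiM {1..n} (\<lambda>_. lborel :: real measure)"
  have nonneg: "0 \<le> fps_nth (path_fps (1 - y)) n" if "0 \<le> y" "y \<le> t" for y
    using Suc.IH[of "1 - y"] Suc.prems that by simp
  have [measurable]: "(\<lambda>y. fps_nth (path_fps (1 - y)) n) \<in> borel_measurable borel"
    by (simp add: path_fps_reflect fps_mult_nth fps_sin_def fps_cos_def)
  have ins: "{1..Suc n} = insert (Suc n) {1..n}"
    by auto
  have "emeasure (?M (Suc n)) (path_slice (Suc n) t)
      = (\<integral>\<^sup>+x. indicator (path_slice (Suc n) t) x \<partial>PiM (insert (Suc n) {1..n}) (\<lambda>_. lborel))"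
    using sets_path_slice[of "Suc n" t] by (simp only: ins nn_integral_indicator)
  \<comment> \<open>The last coordinate becomes the outer variable, so the inner integral is the
    volume of a shorter slice.\<close>
  also have "\<dots> = (\<integral>\<^sup>+y. \<integral>\<^sup>+x. indicator (path_slice (Suc n) t) (x(Suc n := y)) \<partial>?M n \<partial>lborel)"
    using sets_path_slice[of "Suc n" t]
    by (intro PiM_lborel.product_nn_integral_insert_rev) (simp_all only: ins, auto)
  also have "\<dots> = (\<integral>\<^sup>+y. \<integral>\<^sup>+x. indicator (path_slice n (1 - y)) x * indicator {0..t} y \<partial>?M n \<partial>lborel)"
    using Suc.prems
    by (intro nn_integral_cong)
       (auto simp: path_slice_Suc_iff space_PiM PiE_iff split: split_indicator)
  also have "\<dots> = (\<integral>\<^sup>+y. emeasure (?M n) (path_slice n (1 - y)) * indicator {0..t} y \<partial>lborel)"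
    using sets_path_slice by (simp add: nn_integral_multc)
  also have "\<dots> = (\<integral>\<^sup>+y. ennreal (fps_nth (path_fps (1 - y)) n) * indicator {0..t} y \<partial>lborel)"
    using Suc by (intro nn_integral_cong) (auto split: split_indicator)
  \<comment> \<open>The fundamental theorem of calculus; the term at 0 vanishes since
    \<open>path_fps 0 = 1\<close>.\<close>
  also have "\<dots> = ennreal (fps_nth (path_fps t) (Suc n) - fps_nth (path_fps 0) (Suc n))"
    using Suc.prems nonneg
    by (intro nn_integral_FTC_Icc DERIV_path_fps_nth[THEN DERIV_subset]) auto
  finally have "emeasure (?M (Suc n)) (path_slice (Suc n) t) = ennreal (fps_nth (path_fps t) (Suc n))"
    by simp
  \<comment> \<open>The left side is 0, so monotonicity in \<open>t\<close> yields the nonnegativity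
    half of the claim.\<close>
  moreover have "fps_nth (path_fps 0) (Suc n) \<le> fps_nth (path_fps t) (Suc n)"
  proof (rule DERIV_nonneg_imp_nondecreasing[of 0 t "\<lambda>t. fps_nth (path_fps t) (Suc n)"])
    fix y assume "0 \<le> y" "y \<le> t"
    then show "\<exists>d. ((\<lambda>t. fps_nth (path_fps t) (Suc n)) has_real_derivative d) (at y) \<and> 0 \<le> d"
      using DERIV_path_fps_nth nonneg by blast
  qed (use Suc.prems in simp)
  ultimately show ?case
    by simp
qed

text \<open>At \<open>t = 1\<close> the bound on the last coordinate is vacuous.\<close>

lemma graph_vol_path_graph_fps: "graph_vol (path_graph n) = fps_nth sec_tan_fps n"
proof -
  have "path_slice n 1 = graph_polytope (path_graph n)"
    by (auto simp: path_slice_def graph_polytope_path_graph PiE_iff)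
  then show ?thesis
    using emeasure_path_slice[of 1 n]
    by (simp add: graph_vol_def measure_def path_graph_def path_fps_1)
qed

lemma sec_tan_fps_eq:
  "sec_tan_fps = Abs_fps (\<lambda>n. if n = 0 then 1 else graph_vol (path_graph n))"
  using path_fps_nth_0[of 1] by (auto simp: fps_eq_iff graph_vol_path_graph_fps path_fps_1)

theorem corollary2p4:
  shows "(\<forall>n::nat. n \<ge> 1 \<longrightarrow> graph_vol (path_graph n) = real (euler_number n) / fact n) \<and>
         (\<lambda>x::real. 1 / cos x + tan x) has_fps_expansion
           Abs_fps (\<lambda>n. if n = 0 then 1 else graph_vol (path_graph n))"
  using graph_vol_path_graph_euler has_fps_expansion_sec_tan unfolding sec_tan_fps_eq by blast

end
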